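(* Let $t\ge2$ and $\mu_B(t)\le u<1$, and assume $b^B_1(t,\omega(u))\ne0$, where $b^B_1(t,w)=(2t+1)w-t(t-4)$. Then $\mathfrak{e}^B_{t,u}\in\mathcal{E}(\mathcal{P}^+_{3,5})$ and $\mathfrak{e}^B_{t,u}(a^2,b^2,c^2)\in\mathcal{E}(\mathcal{P}_{3,10})$.
   Context: Let $a,b,c$ be variables. For nonnegative integers $m,n$ put $S_{m,n}=a^mb^n+b^mc^n+c^ma^n$, $S_n=S_{n,0}=a^n+b^n+c^n$, $T_{m,n}=S_{m,n}+S_{n,m}$, $U=abc$ (so $S_{1,1}=ab+bc+ca$). Put $s_0=S_5-US_{1,1}$, $s_1=T_{4,1}-2US_{1,1}$, $s_2=T_{3,2}-2US_{1,1}$, $s_3=US_2-US_{1,1}$, $s_4=US_{1,1}$. $\mathcal{P}^+_{3,5}$ is the cone of all real homogeneous quintic forms in $a,b,c$ nonnegative on $\mathbb{R}^3_{\ge0}$; $\mathcal{P}_{3,10}$ is the cone of real ternary forms of degree 10 nonnegative on $\mathbb{R}^3$. For a closed convex cone $\mathcal{P}$, $f\in\mathcal{P}\setminus\{0\}$ is extremal if $f=g+h$ with $g,h\in\mathcal{P}$ forces $g,h\in\mathbb{R}_{\ge0}f$; $\mathcal{E}(\mathcal{P})$ is the set of extremal elements. Auxiliary functions: $\mu_R(t)=2-t^2+t\sqrt{(t-1)(t+2)}$, $\mu_B(t)=\tfrac12\big(\mu_R(t)-\sqrt{\mu_R(t)^2-4}\big)$ (for $t\ge2$), $\omega(u)=u+\frac1u-2$.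 Family B: with $p^B_1(t,w)=-2w-3$, $p^B_2(t,w)=w^2+2w+2$, $p^B_3(t,w)=-\frac{2t^3+4t^2+5t+1}{t^2(t+2)}w^2+\frac{2(4t^2+5t+3)}{t+2}w-\frac{3t^3-7t^2-12t-8}{t+2}$, $p^B_4(t,w)=\frac{(t-1)^3(-w^2-2t^2w+t^2(t-2))}{t^2(t+2)}$, put $\mathfrak{e}^B_{t,u}=s_0+\sum_{i=1}^4p^B_i(t,\omega(u))s_i$. *)

theory Defs
  imports Complex_Main
begin

type_synonym tform = "real \<Rightarrow> real \<Rightarrow> real \<Rightarrow> real"

definition ternary_form :: "nat \<Rightarrow> tform \<Rightarrow> bool" where
  "ternary_form d f \<longleftrightarrow>
     (\<exists>coef :: nat \<Rightarrow> nat \<Rightarrow> real. \<forall>a b c.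
        f a b c = (\<Sum>i\<le>d. \<Sum>j\<le>d - i. coef i j * a ^ i * b ^ j * c ^ (d - i - j)))"

definition P_plus_3_5 :: "tform set" where
  "P_plus_3_5 = {f. ternary_form 5 f \<and>
      (\<forall>a b c. 0 \<le> a \<longrightarrow> 0 \<le> b \<longrightarrow> 0 \<le> c \<longrightarrow> 0 \<le> f a b c)}"

definition P_3_10 :: "tform set" where
  "P_3_10 = {f. ternary_form 10 f \<and> (\<forall>a b c. 0 \<le> f a b c)}"

definition extremal :: "tform set \<Rightarrow> tform \<Rightarrow> bool" where
  "extremal P f \<longleftrightarrow> f \<in> P \<and> f \<noteq> (\<lambda>a b c. 0) \<and>
     (\<forall>g h. g \<in> P \<longrightarrow> h \<in> P \<longrightarrow> f = (\<lambda>a b c. g a b c + h a b c) \<longrightarrow>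
        (\<exists>l\<ge>0. g = (\<lambda>a b c. l * f a b c)) \<and> (\<exists>l\<ge>0. h = (\<lambda>a b c. l * f a b c)))"

definition SS :: "nat \<Rightarrow> nat \<Rightarrow> tform" where
  "SS m n a b c = a ^ m * b ^ n + b ^ m * c ^ n + c ^ m * a ^ n"

definition S1 :: "nat \<Rightarrow> tform" where
  "S1 n = SS n 0"

definition TT :: "nat \<Rightarrow> nat \<Rightarrow> tform" where
  "TT m n a b c = SS m n a b c + SS n m a b c"

definition UU :: tform where
  "UU a b c = a * b * c"

definition s0 :: tform where "s0 a b c = S1 5 a b c - UU a b c * SS 1 1 a b c"
definition s1 :: tform where "s1 a b c = TT 4 1 a b c - 2 * UU a b c * SS 1 1 a b c"
definition s2 :: tform where "s2 a b c = TT 3 2 a b c - 2 * UU a b c * SS 1 1 a b c"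
definition s3 :: tform where "s3 a b c = UU a b c * S1 2 a b c - UU a b c * SS 1 1 a b c"
definition s4 :: tform where "s4 a b c = UU a b c * SS 1 1 a b c"

definition mu_R :: "real \<Rightarrow> real" where
  "mu_R t = 2 - t ^ 2 + t * sqrt ((t - 1) * (t + 2))"

definition mu_B :: "real \<Rightarrow> real" where
  "mu_B t = (mu_R t - sqrt (mu_R t ^ 2 - 4)) / 2"

definition omega :: "real \<Rightarrow> real" where
  "omega u = u + 1 / u - 2"

definition pB1 :: "real \<Rightarrow> real \<Rightarrow> real" where "pB1 t w = - 2 * w - 3"
definition pB2 :: "real \<Rightarrow> real \<Rightarrow> real" where "pB2 t w = w ^ 2 + 2 * w + 2"
definition pB3 :: "real \<Rightarrow> real \<Rightarrow> real" where
  "pB3 t w = - ((2 * t ^ 3 + 4 * t ^ 2 + 5 * t + 1) / (t ^ 2 * (t + 2))) * w ^ 2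
             + (2 * (4 * t ^ 2 + 5 * t + 3) / (t + 2)) * w
             - (3 * t ^ 3 - 7 * t ^ 2 - 12 * t - 8) / (t + 2)"
definition pB4 :: "real \<Rightarrow> real \<Rightarrow> real" where
  "pB4 t w = (t - 1) ^ 3 * (- (w ^ 2) - 2 * t ^ 2 * w + t ^ 2 * (t - 2)) / (t ^ 2 * (t + 2))"

definition bB1 :: "real \<Rightarrow> real \<Rightarrow> real" where
  "bB1 t w = (2 * t + 1) * w - t * (t - 4)"

definition eB :: "real \<Rightarrow> real \<Rightarrow> tform" where
  "eB t u a b c = (let w = omega u in
      s0 a b c + pB1 t w * s1 a b c + pB2 t w * s2 a b c + pB3 t w * s3 a b c + pB4 t w * s4 a b c)"

end

theory Submission
  imports Defs
begin

text \<open>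
  Write \<open>w = \<omega>(u)\<close> and \<open>f = e\<^sup>B\<close>. A symmetric quintic is affine in \<open>abc\<close> once \<open>a + b + c\<close> and \<open>ab + bc + ca\<close>
  are fixed, so \<open>f \<ge> 0\<close> on the orthant has to be checked only at \<open>(x, y, y)\<close> and \<open>(x, y, 0)\<close>, where \<open>f\<close>
  factors explicitly. The zeros used are \<open>(u, 1, 0)\<close>, \<open>(t, 1, 1)\<close> and their permutations.

  If \<open>0 \<le> g \<le> f\<close>, then \<open>g\<close> vanishes to second order at the interior zeros, and so does its restriction to
  each edge at the edge zeros. These are linear conditions on the coefficients of \<open>g\<close>. On the part of \<open>g\<close>
  that is antisymmetric under a transposition they reduce to a \<open>3 \<times> 3\<close> system whose determinant is a
  nonzero multiple of \<open>b\<^sub>1(t, w)\<close>; on the symmetric part they leave only the multiples of \<open>f\<close>.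

  In degree 10 the sign changes of the variables split \<open>G\<close> into an even part, covered by the quintic case, and
  three parts of the form \<open>a b K(a\<^sup>2, b\<^sup>2, c\<^sup>2)\<close> with \<open>\<surd>(ab) \<bar>K\<bar> \<le> f\<close> on the orthant. The linear conditions on the
  quartic \<open>K\<close> have only the trivial solution, the decisive determinant being a nonzero multiple of
  \<open>b\<^sub>1(t, w)\<^sup>2\<close>.
\<close>

subsection \<open>Symmetric quintics on the orthant\<close>

lemma symmetric_quintic_nonneg:
  fixes k0 k1 k2 k3 k4 a b c :: real
  defines "F \<equiv> \<lambda>a b c. k0 * s0 a b c + k1 * s1 a b c + k2 * s2 a b c + k3 * s3 a b c + k4 * s4 a b c"
  assumes diag: "\<And>x y. 0 \<le> x \<Longrightarrow> 0 \<le> y \<Longrightarrow> 0 \<le> F x y y"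
    and edge: "\<And>x y. 0 \<le> x \<Longrightarrow> 0 \<le> y \<Longrightarrow> 0 \<le> F x y 0"
    and nonneg: "0 \<le> a" "0 \<le> b" "0 \<le> c"
  shows "0 \<le> F a b c"
proof -
  define p q r where "p = a + b + c" and "q = a * b + b * c + c * a" and "r = a * b * c"
  define B where "B = k0 * (5 * p^2 - 6 * q) + k1 * (3 * q - p^2) + k2 * (- 2 * p^2 - 3 * q)
    + k3 * (p^2 - 3 * q) + k4 * q"
  define A where "A = k0 * (p^5 - 5 * p^3 * q + 5 * p * q^2)
    + k1 * (p * (p^4 - 4 * p^2 * q + 2 * q^2) - (p^5 - 5 * p^3 * q + 5 * p * q^2))
    + k2 * ((p^3 - 3 * p * q) * (p^2 - 2 * q) - (p^5 - 5 * p^3 * q + 5 * p * q^2))"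
  have lin: "F x y z = A + B * (x * y * z)"
    if "x + y + z = p" "x * y + y * z + z * x = q" for x y z
    unfolding F_def A_def B_def s0_def s1_def s2_def s3_def s4_def TT_def S1_def SS_def UU_def
      that[symmetric]
    by (simp add: power_0) algebra
  have p0: "0 \<le> p" and q0: "0 \<le> q" and r0: "0 \<le> r"
    using nonneg by (simp_all add: p_def q_def r_def)
  have "p^2 - 3 * q = ((a - b)^2 + (b - c)^2 + (c - a)^2) / 2"
    by (simp add: p_def q_def power2_eq_square field_simps)
  then have pq: "0 \<le> p^2 - 3 * q" by (simp only:) simp
  define s where "s = sqrt (p^2 - 3 * q)"
  have s0: "0 \<le> s" and s2: "s^2 = p^2 - 3 * q" using pq by (simp_all add: s_def)
  have sp: "s \<le> p" using s2 q0 p0 by (intro power2_le_imp_le[of s p]) simp_all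
  \<comment> \<open>The right side is 27 times the discriminant of the cubic with roots
    \<open>a\<close>, \<open>b\<close>, \<open>c\<close>. Its nonnegativity confines
    \<open>r\<close> to the interval between its values at \<open>(p + 2s, p - s, p - s)/3\<close>
    and \<open>(p - 2s, p + s, p + s)/3\<close>, the configurations with a repeated root.\<close>
  have "(2 * s^3)^2 - (2 * p^3 - 9 * p * q + 27 * r)^2 = 27 * ((a - b) * (b - c) * (c - a))^2"
  proof -
    have "4 * (p^2 - 3 * q)^3 - (2 * p^3 - 9 * p * q + 27 * r)^2 = 27 * ((a - b) * (b - c) * (c - a))^2"
      unfolding p_def q_def r_def by algebra
    moreover have "(2 * s^3)^2 = 4 * (s^2)^3" by algebra
    ultimately show ?thesis unfolding s2 by simp
  qed
  then have "(2 * p^3 - 9 * p * q + 27 * r)^2 \<le> (2 * s^3)^2"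
    using zero_le_power2[of "(a - b) * (b - c) * (c - a)"] by linarith
  then have disc: "\<bar>2 * p^3 - 9 * p * q + 27 * r\<bar> \<le> 2 * s^3"
    using s0 abs_le_square_iff[of "2 * p^3 - 9 * p * q + 27 * r" "2 * s^3"] by simp
  have Fr: "F a b c = A + B * r"
    using lin[of a b c] by (simp add: p_def q_def r_def)
  have q_s: "3 * q = p^2 - s^2" using s2 by simp
  \<comment> \<open>The sign of \<open>B\<close> decides whether the largest or the smallest
    admissible \<open>r\<close> minimises \<open>A + B * r\<close>. The largest is attained in the
    orthant because \<open>s <= p\<close>; the smallest only if \<open>2 * s <= p\<close>.\<close>
  show ?thesis
  proof (cases "0 \<le> B")
    case False
    define x y where "x = (p + 2 * s) / 3" and "y = (p - s) / 3"
    have "0 \<le> F x y y" using p0 s0 sp by (intro diag) (simp_all add: x_def y_def)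
    also have "F x y y = A + B * (x * y * y)"
      using q_s by (intro lin) (simp_all add: x_def y_def field_simps power2_eq_square)
    also have "27 * (x * y * y) = 9 * p * q - 2 * p^3 + 2 * s^3"
    proof -
      have "27 * (x * y * y) = (p + 2 * s) * (p - s)^2"
        by (simp add: x_def y_def power2_eq_square)
      also have "\<dots> = 9 * p * q - 2 * p^3 + 2 * s^3" using q_s by algebra
      finally show ?thesis .
    qed
    then have "r \<le> x * y * y" using disc by linarith
    then have "B * (x * y * y) \<le> B * r" using False by (intro mult_left_mono_neg) simp_all
    finally show ?thesis using Fr by linarith
  next
    case True
    show ?thesis
    proof (cases "2 * s \<le> p")
      case le: True
      define x y where "x = (p - 2 * s) / 3" and "y = (p + s) / 3"
      have "0 \<le> F x y y" using p0 s0 le by (intro diag) (simp_all add: x_def y_def)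
      also have "F x y y = A + B * (x * y * y)"
        using q_s by (intro lin) (simp_all add: x_def y_def field_simps power2_eq_square)
      also have "27 * (x * y * y) = 9 * p * q - 2 * p^3 - 2 * s^3"
      proof -
        have "27 * (x * y * y) = (p - 2 * s) * (p + s)^2"
          by (simp add: x_def y_def power2_eq_square)
        also have "\<dots> = 9 * p * q - 2 * p^3 - 2 * s^3" using q_s by algebra
        finally show ?thesis .
      qed
      then have "x * y * y \<le> r" using disc by linarith
      then have "B * (x * y * y) \<le> B * r" using True by (intro mult_left_mono)
      finally show ?thesis using Fr by linarith
    next
      case False
      \<comment> \<open>The inequality \<open>p < 2 * s\<close> forces \<open>p^2 >= 4 * q\<close>,
        so some \<open>(x, y, 0)\<close> in the orthant shares \<open>p\<close> and
        \<open>q\<close>. Its product is 0, a lower bound for \<open>r\<close>.\<close>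
      then have "p^2 \<le> (2 * s)^2" using p0 by (intro power_mono) simp_all
      then have h: "0 \<le> p^2 - 4 * q" using s2 by (simp add: power_mult_distrib)
      define e where "e = sqrt (p^2 - 4 * q)"
      have e0: "0 \<le> e" and e2: "e^2 = p^2 - 4 * q" using h by (simp_all add: e_def)
      have ep: "e \<le> p" using e2 q0 p0 by (intro power2_le_imp_le[of e p]) simp_all
      define x y where "x = (p + e) / 2" and "y = (p - e) / 2"
      have "0 \<le> F x y 0" using p0 e0 ep by (intro edge) (simp_all add: x_def y_def)
      also have "F x y 0 = A + B * (x * y * 0)"
        using e2 by (intro lin) (simp_all add: x_def y_def field_simps power2_eq_square)
      finally have "0 \<le> A" by simp
      then show ?thesis using Fr True r0 by simp
    qed
  qed
qed

lemma eB_eq: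
  "eB t u a b c = 1 * s0 a b c + pB1 t (omega u) * s1 a b c + pB2 t (omega u) * s2 a b c
     + pB3 t (omega u) * s3 a b c + pB4 t (omega u) * s4 a b c"
  by (simp add: eB_def Let_def)

lemma nonneg_if_scaled_nonneg: "0 \<le> k * x \<Longrightarrow> 0 < k \<Longrightarrow> 0 \<le> (x :: real)"
  by (simp add: zero_le_mult_iff)

subsection \<open>Zeros and domination\<close>

text \<open>Double roots at the reciprocal pair \<open>u\<close>, \<open>v\<close> force the
  factorization \<open>(x^2 - (u + v) * x + 1)^2 * (c5 * x + c0)\<close>; the conclusions compare
  coefficients.\<close>

lemma quintic_double_roots:
  fixes u v :: real
  assumes "u * v = 1" "u \<noteq> v"
    and "c0 + c1 * u + c2 * u^2 + c3 * u^3 + c4 * u^4 + c5 * u^5 = 0"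
    and "c1 + 2 * c2 * u + 3 * c3 * u^2 + 4 * c4 * u^3 + 5 * c5 * u^4 = 0"
    and "c0 + c1 * v + c2 * v^2 + c3 * v^3 + c4 * v^4 + c5 * v^5 = 0"
    and "c1 + 2 * c2 * v + 3 * c3 * v^2 + 4 * c4 * v^3 + 5 * c5 * v^4 = 0"
  shows "c1 = c5 - 2 * (u + v) * c0" "c2 = ((u + v)^2 + 2) * c0 - 2 * (u + v) * c5"
    "c3 = ((u + v)^2 + 2) * c5 - 2 * (u + v) * c0" "c4 = c0 - 2 * (u + v) * c5"
proof -
  define \<sigma> d0 d1 d2 d3 where "\<sigma> = u + v" and "d0 = c1 - (c5 - 2 * \<sigma> * c0)"
    and "d1 = c2 - ((\<sigma>^2 + 2) * c0 - 2 * \<sigma> * c5)"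
    and "d2 = c3 - ((\<sigma>^2 + 2) * c5 - 2 * \<sigma> * c0)" and "d3 = c4 - (c0 - 2 * \<sigma> * c5)"
  have nz: "u \<noteq> 0" "v \<noteq> 0" "u - v \<noteq> 0" using assms by auto
  note defs = d0_def d1_def d2_def d3_def \<sigma>_def
  \<comment> \<open>Subtracting that product leaves
    \<open>x * (d0 + d1 * x + d2 * x^2 + d3 * x^3)\<close>, and a cubic with two distinct double
    roots is zero.\<close>
  have "u * (d0 + d1 * u + d2 * u^2 + d3 * u^3) = 0" using assms(1,3) unfolding defs by algebra
  then have eu: "d0 + d1 * u + d2 * u^2 + d3 * u^3 = 0" using nz by simp
  have "v * (d0 + d1 * v + d2 * v^2 + d3 * v^3) = 0" using assms(1,5) unfolding defs by algebra
  then have ev: "d0 + d1 * v + d2 * v^2 + d3 * v^3 = 0" using nz by simp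
  have "d0 + 2 * d1 * u + 3 * d2 * u^2 + 4 * d3 * u^3 = 0" using assms(1,4) unfolding defs by algebra
  then have "u * (d1 + 2 * d2 * u + 3 * d3 * u^2) = 0" using eu by algebra
  then have du: "d1 + 2 * d2 * u + 3 * d3 * u^2 = 0" using nz by simp
  have "d0 + 2 * d1 * v + 3 * d2 * v^2 + 4 * d3 * v^3 = 0" using assms(1,6) unfolding defs by algebra
  then have "v * (d1 + 2 * d2 * v + 3 * d3 * v^2) = 0" using ev by algebra
  then have dv: "d1 + 2 * d2 * v + 3 * d3 * v^2 = 0" using nz by simp
  have "(u - v) * (2 * d2 + 3 * d3 * (u + v)) = 0" using du dv by algebra
  then have 1: "2 * d2 + 3 * d3 * (u + v) = 0" using nz by simp
  have "(u - v)^2 * (d2 + d3 * (v + 2 * u)) = 0" using eu ev du by algebra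
  then have 2: "d2 + d3 * (v + 2 * u) = 0" using nz by simp
  have "d3 * (u - v) = 0" using 1 2 by algebra
  then have "d3 = 0" using nz by simp
  moreover then have "d2 = 0" using 1 by simp
  moreover then have "d1 = 0" using du \<open>d3 = 0\<close> by simp
  moreover then have "d0 = 0" using eu \<open>d3 = 0\<close> \<open>d2 = 0\<close> by simp
  ultimately show "c1 = c5 - 2 * (u + v) * c0" "c2 = ((u + v)^2 + 2) * c0 - 2 * (u + v) * c5"
    "c3 = ((u + v)^2 + 2) * c5 - 2 * (u + v) * c0" "c4 = c0 - 2 * (u + v) * c5"
    by (simp_all add: defs)
qed

text \<open>Both \<open>\<psi>\<close> and \<open>\<psi> - \<phi>\<close> are nonnegative near
  \<open>x\<close> and vanish there, so both have a local minimum and zero derivative.\<close>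

lemma dominated_at_zero:
  fixes \<phi> \<psi> :: "real \<Rightarrow> real"
  assumes "d > 0" and dom: "\<And>s. \<bar>s - x\<bar> < d \<Longrightarrow> \<bar>\<phi> s\<bar> \<le> \<psi> s" and zero: "\<psi> x = 0"
    and "\<psi> differentiable (at x)" and \<phi>: "(\<phi> has_real_derivative D) (at x)"
  shows "\<phi> x = 0" "D = 0"
proof -
  obtain E where E: "(\<psi> has_real_derivative E) (at x)"
    using assms(4) by (auto simp: real_differentiable_def)
  show z: "\<phi> x = 0" using dom[of x] zero \<open>d > 0\<close> by simp
  have "E = 0"
    by (rule DERIV_local_min[OF E \<open>d > 0\<close>]) (use dom in \<open>force simp: zero abs_minus_commute\<close>)
  moreover have "E - D = 0"
    by (rule DERIV_local_min[OF DERIV_diff[OF E \<phi>] \<open>d > 0\<close>])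
      (use dom in \<open>force simp: zero z abs_minus_commute abs_le_iff\<close>)
  ultimately show "D = 0" by simp
qed

text \<open>A weight that is nonzero at \<open>x\<close> does not affect vanishing to second order,
  by the product rule. In degree 10 the weight is a square root; otherwise it is 1.\<close>

lemma weighted_quintic_dominated_at_zero:
  fixes \<kappa> \<psi> :: "real \<Rightarrow> real"
  assumes "d > 0"
    and dom: "\<And>s. \<bar>s - x\<bar> < d \<Longrightarrow>
      \<bar>\<kappa> s * (c0 + c1 * s + c2 * s^2 + c3 * s^3 + c4 * s^4 + c5 * s^5)\<bar> \<le> \<psi> s"
    and "\<psi> x = 0" and "\<psi> differentiable (at x)" and "\<kappa> differentiable (at x)" and "\<kappa> x \<noteq> 0"
  shows "c0 + c1 * x + c2 * x^2 + c3 * x^3 + c4 * x^4 + c5 * x^5 = 0"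
    and "c1 + 2 * c2 * x + 3 * c3 * x^2 + 4 * c4 * x^3 + 5 * c5 * x^4 = 0"
proof -
  define P where "P s = c0 + c1 * s + c2 * s^2 + c3 * s^3 + c4 * s^4 + c5 * s^5" for s :: real
  define P' where "P' s = c1 + 2 * c2 * s + 3 * c3 * s^2 + 4 * c4 * s^3 + 5 * c5 * s^4" for s :: real
  have P: "(P has_real_derivative P' x) (at x)" unfolding P_def P'_def
    by (auto intro!: derivative_eq_intros simp: algebra_simps)
  obtain K where K: "(\<kappa> has_real_derivative K) (at x)"
    using assms(5) by (auto simp: real_differentiable_def)
  note * = dominated_at_zero[OF \<open>d > 0\<close> dom[folded P_def] assms(3,4) DERIV_mult[OF K P], simplified]
  have "P x = 0" using * assms(6) by simp
  moreover have "P' x = 0" using * assms(6) \<open>P x = 0\<close> by simp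
  ultimately show "c0 + c1 * x + c2 * x^2 + c3 * x^3 + c4 * x^4 + c5 * x^5 = 0"
    and "c1 + 2 * c2 * x + 3 * c3 * x^2 + 4 * c4 * x^3 + 5 * c5 * x^4 = 0"
    by (simp_all add: P_def P'_def)
qed

lemma sqrt_mult_differentiable:
  assumes "0 < x" shows "(\<lambda>s. sqrt (s * y)) differentiable (at x)"
proof -
  have "sqrt differentiable (at x)"
    using DERIV_real_sqrt[OF assms] by (auto simp: real_differentiable_def)
  then show ?thesis unfolding real_sqrt_mult by (intro differentiable_mult differentiable_const)
qed

lemma cramer3:
  fixes x y z :: real
  assumes "a1 * x + b1 * y + c1 * z = 0" "a2 * x + b2 * y + c2 * z = 0" "a3 * x + b3 * y + c3 * z = 0"
    and "a1 * (b2 * c3 - b3 * c2) - b1 * (a2 * c3 - a3 * c2) + c1 * (a2 * b3 - a3 * b2) \<noteq> 0"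
  shows "x = 0" "y = 0" "z = 0"
proof -
  let ?D = "a1 * (b2 * c3 - b3 * c2) - b1 * (a2 * c3 - a3 * c2) + c1 * (a2 * b3 - a3 * b2)"
  have "?D * x = 0" "?D * y = 0" "?D * z = 0" using assms(1-3) by algebra+
  then show "x = 0" "y = 0" "z = 0" using assms(4) by simp_all
qed

subsection \<open>Ternary forms\<close>

text \<open>Unrolls sums with numeral bounds, turning a form into explicit monomials on which
  \<open>algebra\<close> can work.\<close>

lemma sum_atMost_numeral:
  "sum F {..numeral n :: nat} = sum F {..pred_numeral n} + (F (numeral n) :: real)"
  by (simp add: numeral_eq_Suc)

lemma ternary_form_squares:
  assumes "ternary_form 5 g"
  shows "ternary_form 10 (\<lambda>a b c. g (a^2) (b^2) (c^2))"
proof -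
  obtain C where C: "\<And>a b c. g a b c = (\<Sum>i\<le>5. \<Sum>j\<le>5 - i. C i j * a ^ i * b ^ j * c ^ (5 - i - j))"
    using assms unfolding ternary_form_def by blast
  define C' where "C' i j = (if even i \<and> even j then C (i div 2) (j div 2) else 0)" for i j :: nat
  have "g (a^2) (b^2) (c^2) = (\<Sum>i\<le>10. \<Sum>j\<le>10 - i. C' i j * a ^ i * b ^ j * c ^ (10 - i - j))" for a b c
    by (simp add: C sum_atMost_numeral C'_def flip: power_mult)
  then show ?thesis unfolding ternary_form_def by blast
qed

subsection \<open>The form of family B\<close>

locale family_B =
  fixes t u :: real
  assumes t_ge: "2 \<le> t" and u_ge: "mu_B t \<le> u" and u_less: "u < 1"
    and b1: "bB1 t (omega u) \<noteq> 0"
begin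

abbreviation "w \<equiv> omega u"
abbreviation "v \<equiv> 1 / u"
abbreviation "f \<equiv> eB t u"

text \<open>Makes \<open>mu_B t\<close> the smaller real root of
  \<open>x^2 - mu_R t * x + 1\<close>; the other root is its reciprocal.\<close>

lemma mu_R_ge: "2 \<le> mu_R t"
proof -
  have "t^2 \<le> (t - 1) * (t + 2)" using t_ge by (simp add: power2_eq_square algebra_simps)
  then have "t \<le> sqrt ((t - 1) * (t + 2))" by (rule real_le_rsqrt)
  then have "t * t \<le> t * sqrt ((t - 1) * (t + 2))" using t_ge by (intro mult_left_mono) simp_all
  then show ?thesis by (simp add: mu_R_def power2_eq_square)
qed

lemma mu_R_sqrt: "0 \<le> sqrt ((mu_R t)^2 - 4)" "(sqrt ((mu_R t)^2 - 4))^2 = (mu_R t)^2 - 4"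
proof -
  have "2^2 \<le> (mu_R t)^2" using mu_R_ge by (intro power_mono) simp_all
  then show "0 \<le> sqrt ((mu_R t)^2 - 4)" "(sqrt ((mu_R t)^2 - 4))^2 = (mu_R t)^2 - 4" by simp_all
qed

lemma u_pos: "0 < u"
proof -
  have "sqrt ((mu_R t)^2 - 4) < mu_R t"
    using mu_R_ge mu_R_sqrt by (intro power2_less_imp_less[of _ "mu_R t"]) simp_all
  then show ?thesis using u_ge by (simp add: mu_B_def)
qed

lemma uv: "u * v = 1" and v_pos: "0 < v" and v_neq: "u \<noteq> v" and u_plus_v: "u + v = w + 2"
proof -
  show "u * v = 1" "0 < v" using u_pos by simp_all
  have "1 < v" using u_pos u_less by simp
  then show "u \<noteq> v" using u_less by linarith
  show "u + v = w + 2" by (simp add: omega_def)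
qed

lemma w_pos: "0 < w"
proof -
  have "w = (1 - u)^2 / u" using u_pos by (simp add: omega_def field_simps power2_eq_square)
  then show ?thesis using u_pos u_less by simp
qed

text \<open>Since \<open>mu_B t <= u < 1\<close>, the number \<open>u\<close> lies between the two
  reciprocal roots, whence \<open>u + 1 / u <= mu_R t\<close>. Isolating the square root and
  squaring gives the bound, which says that \<open>pB4 t w\<close> is nonnegative.\<close>

lemma w_bound: "w^2 + 2 * t^2 * w \<le> t^2 * (t - 2)"
proof -
  let ?r = "sqrt ((mu_R t)^2 - 4)"
  have "(u - (mu_R t - ?r) / 2) * (u - (mu_R t + ?r) / 2) \<le> 0"
    using u_ge u_less mu_R_sqrt(1) mu_R_ge by (intro mult_nonneg_nonpos) (simp_all add: mu_B_def)
  also have "(u - (mu_R t - ?r) / 2) * (u - (mu_R t + ?r) / 2) = u^2 - mu_R t * u + 1"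
    using mu_R_sqrt(2) by (simp add: field_simps power2_eq_square)
  finally have "u^2 + 1 \<le> mu_R t * u" by simp
  then have "(u^2 + 1) / u \<le> mu_R t" using u_pos by (simp add: field_simps)
  moreover have "(u^2 + 1) / u = w + 2" using u_pos by (simp add: omega_def field_simps power2_eq_square)
  ultimately have "w + t^2 \<le> t * sqrt ((t - 1) * (t + 2))" by (simp add: mu_R_def)
  moreover have "0 \<le> w + t^2" using w_pos by simp
  ultimately have "(w + t^2)^2 \<le> (t * sqrt ((t - 1) * (t + 2)))^2" by (intro power_mono)
  also have "\<dots> = t^2 * ((t - 1) * (t + 2))" using t_ge by (simp add: power_mult_distrib)
  finally show ?thesis by (simp add: power2_eq_square algebra_simps)
qed

text \<open>Used for the strict positivity of the cofactors of \<open>bB1 t w\<close> in the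
  determinants below.\<close>

lemma w_less: "2 * w < t"
proof -
  have "t^2 * (2 * w) < t^2 * t"
    using w_bound w_pos t_ge zero_less_power[of w 2] zero_less_power[of t 2] unfolding right_diff_distrib
    by linarith
  then show ?thesis using t_ge by simp
qed

section \<open>Boundary factorizations and nonnegativity on the orthant\<close>

lemma f_edge: "f x y 0 = (x + y) * (x^2 - (w + 2) * x * y + y^2)^2"
  by (simp add: eB_eq pB1_def pB2_def s0_def s1_def s2_def s3_def s4_def TT_def S1_def SS_def UU_def)
    algebra

lemma f_sym: "f b a c = f a b c" "f a c b = f a b c"
  unfolding eB_eq s0_def s1_def s2_def s3_def s4_def TT_def S1_def SS_def UU_def
  by (simp_all only: power_0) algebra+

lemma t_denominator_pos: "0 < t^2 * (t + 2)" using t_ge by simp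

text \<open>Clearing the denominators once keeps the later identities polynomial.\<close>

lemma pB3_scaled: "t^2 * (t + 2) * pB3 t w = - (2 * t^3 + 4 * t^2 + 5 * t + 1) * w^2
    + 2 * (4 * t^2 + 5 * t + 3) * t^2 * w - t^2 * (3 * t^3 - 7 * t^2 - 12 * t - 8)"
proof -
  have "T * S * (- (X / (T * S)) * W + Y / S * z - Z / S) = - X * W + Y * T * z - T * Z"
    if "T \<noteq> 0" "S \<noteq> 0" for T S X Y Z W z :: real
    using that by (simp add: field_simps)
  moreover have "t^2 \<noteq> 0" "t + 2 \<noteq> 0" using t_ge by auto
  ultimately show ?thesis unfolding pB3_def by blast
qed

lemma pB4_scaled: "t^2 * (t + 2) * pB4 t w = (t - 1)^3 * (- (w^2) - 2 * t^2 * w + t^2 * (t - 2))"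
  using t_denominator_pos unfolding pB4_def times_divide_eq_right by (intro nonzero_mult_div_cancel_left) linarith

lemma f_diag: "t^2 * (t + 2) * f x 1 1 = (x - t)^2 * ((t + 2) * (x - 1)^2 * (t^2 * x + 2 * w^2)
    + (t^2 * (t - 2) - 2 * t^2 * w - w^2) * x * (2 * (t + 2) * x + t - 7))"
proof -
  have "t^2 * (t + 2) * f x 1 1 = t^2 * (t + 2) * (s0 x 1 1 + pB1 t w * s1 x 1 1 + pB2 t w * s2 x 1 1)
      + t^2 * (t + 2) * pB3 t w * s3 x 1 1 + t^2 * (t + 2) * pB4 t w * s4 x 1 1"
    by (simp add: eB_eq algebra_simps)
  also have "\<dots> = (x - t)^2 * ((t + 2) * (x - 1)^2 * (t^2 * x + 2 * w^2)
    + (t^2 * (t - 2) - 2 * t^2 * w - w^2) * x * (2 * (t + 2) * x + t - 7))"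
    unfolding pB3_scaled pB4_scaled
    by (simp add: pB1_def pB2_def s0_def s1_def s2_def s3_def s4_def TT_def S1_def SS_def UU_def) algebra
  finally show ?thesis .
qed

lemma f_t11: "f t 1 1 = 0"
proof -
  have "t^2 * (t + 2) * f t 1 1 = 0" unfolding f_diag by simp
  then show ?thesis using t_ge by simp
qed

lemma f_diag_nonneg:
  assumes "0 \<le> x" shows "0 \<le> f x 1 1"
proof -
  let ?d = "t^2 * (t - 2) - 2 * t^2 * w - w^2" and ?L = "2 * (t + 2) * x + t - 7"
  have w2: "0 < w^2" "0 \<le> 2 * t^2 * w" using w_pos by simp_all
  have d: "0 \<le> ?d" "?d \<le> t^2 * (t - 2)" using w_bound w2 by linarith+
  \<comment> \<open>At \<open>t = 2\<close> the bound on \<open>w\<close> would contradict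
    \<open>w > 0\<close>.\<close>
  have t2: "0 < t - 2"
  proof -
    have "0 < t^2 * (t - 2)" using w_bound w2 by linarith
    then show ?thesis using t_ge by (simp add: zero_less_mult_iff)
  qed
  \<comment> \<open>\<open>t^2 * ?q\<close> is the value of
    \<open>(t + 2) * (x - 1)^2 * t^2 + ?d * ?L\<close> at \<open>?d = t^2 * (t - 2)\<close>. The
    detour is needed because \<open>?L\<close> may be negative.\<close>
  let ?q = "(t + 2) * x^2 + 2 * (t + 2) * (t - 3) * x + (t - 4)^2"
  have q: "0 \<le> ?q"
  proof (cases "3 \<le> t")
    case True
    then show ?thesis using assms by simp
  next
    case False
    \<comment> \<open>Below 3 the linear coefficient is negative, so the square in \<open>x\<close>
      is completed.\<close>
    have "(t + 2) * ?q = ((t + 2) * (x + t - 3))^2 + (t + 2) * ((t - 2) * (1 + t * (3 - t)))" 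
      by algebra
    moreover have "0 \<le> (t + 2) * ((t - 2) * (1 + t * (3 - t)))" using False t_ge by simp
    ultimately have "0 \<le> (t + 2) * ?q" by simp
    then show ?thesis using t_ge by (simp add: zero_le_mult_iff)
  qed
  \<comment> \<open>the bracket on the left is affine in \<open>?d\<close>: interpolate between \<open>?d = 0\<close> and \<open>?d = t\<^sup>2 (t - 2)\<close>\<close>
  have "t^2 * (t - 2) * ((t + 2) * (x - 1)^2 * t^2 + ?d * ?L)
      = (t^2 * (t - 2) - ?d) * ((t + 2) * (x - 1)^2 * t^2) + ?d * (t^2 * ?q)"
    by algebra
  also have "0 \<le> \<dots>"
  proof (rule add_nonneg_nonneg)
    show "0 \<le> (t^2 * (t - 2) - ?d) * ((t + 2) * (x - 1)^2 * t^2)" using d(2) t_ge by (intro mult_nonneg_nonneg) simp_all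
    show "0 \<le> ?d * (t^2 * ?q)" using d(1) q by (intro mult_nonneg_nonneg) simp_all
  qed
  finally have "0 \<le> (t + 2) * (x - 1)^2 * t^2 + ?d * ?L"
    by (rule nonneg_if_scaled_nonneg) (use t2 t_ge in simp)
  then have "0 \<le> x * ((t + 2) * (x - 1)^2 * t^2 + ?d * ?L) + 2 * (t + 2) * (x - 1)^2 * w^2"
    by (rule add_nonneg_nonneg[OF mult_nonneg_nonneg[OF assms]]) (use t_ge in simp)
  also have "\<dots> = (t + 2) * (x - 1)^2 * (t^2 * x + 2 * w^2) + ?d * x * ?L"
    by (simp add: distrib_left distrib_right mult_ac)
  finally have "0 \<le> t^2 * (t + 2) * f x 1 1" unfolding f_diag by (rule mult_nonneg_nonneg[OF zero_le_power2])
  then show ?thesis using t_denominator_pos by (rule nonneg_if_scaled_nonneg)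
qed

lemma f_homogeneous: "f (k * a) (k * b) (k * c) = k^5 * f a b c"
  unfolding eB_eq s0_def s1_def s2_def s3_def s4_def TT_def S1_def SS_def UU_def
  by (simp only: power_0) algebra

lemma f_nonneg:
  assumes "0 \<le> a" "0 \<le> b" "0 \<le> c" shows "0 \<le> f a b c"
  unfolding eB_eq
proof (rule symmetric_quintic_nonneg[OF _ _ assms], unfold eB_eq[symmetric])
  show edge: "0 \<le> f x y 0" if "0 \<le> x" "0 \<le> y" for x y
    using that unfolding f_edge by simp
  show "0 \<le> f x y y" if "0 \<le> x" "0 \<le> y" for x y
  proof (cases "y = 0")
    case True
    then show ?thesis using edge[OF that] by simp
  next
    case False
    then have "f x y y = y^5 * f (x / y) 1 1" using f_homogeneous[of y "x / y" 1 1] by simp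
    then show ?thesis using f_diag_nonneg[of "x / y"] that by simp
  qed
qed

subsection \<open>Forms dominated by the form of family B\<close>

lemma f_u10: "f u 1 0 = 0" and f_v10: "f v 1 0 = 0"
proof -
  have *: "x^2 - (x + y) * x * 1 + 1^2 = 0" if "x * y = 1" for x y :: real
    using that unfolding power_one by algebra
  have "u^2 - (w + 2) * u * 1 + 1^2 = 0" "v^2 - (w + 2) * v * 1 + 1^2 = 0"
    using *[OF uv] *[OF uv[unfolded mult.commute[of u]]] unfolding u_plus_v add.commute[of v] by simp_all
  then show "f u 1 0 = 0" "f v 1 0 = 0" unfolding f_edge by simp_all
qed

lemma f_differentiable: "(\<lambda>s. f s y z) differentiable (at x)"
  unfolding eB_eq s0_def s1_def s2_def s3_def s4_def TT_def S1_def SS_def UU_def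
  by (intro derivative_intros)

text \<open>A zero of \<open>f\<close> with positive first coordinate yields two linear conditions
  on the restriction to this line. The neighbourhood of radius \<open>x\<close> stays in the
  orthant; symmetry of \<open>f\<close> supplies the other directions.\<close>

lemma dominated_on_line:
  assumes "0 < x" "f x y z = 0"
    and dom: "\<And>s. 0 \<le> s \<Longrightarrow>
      \<bar>\<kappa> s * (c0 + c1 * s + c2 * s^2 + c3 * s^3 + c4 * s^4 + c5 * s^5)\<bar> \<le> C * f s y z"
    and "\<kappa> differentiable (at x)" and "\<kappa> x \<noteq> 0"
  shows "c0 + c1 * x + c2 * x^2 + c3 * x^3 + c4 * x^4 + c5 * x^5 = 0"
    and "c1 + 2 * c2 * x + 3 * c3 * x^2 + 4 * c4 * x^3 + 5 * c5 * x^4 = 0"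
proof -
  have *: "(\<lambda>s. C * f s y z) differentiable (at x)"
    by (intro derivative_intros f_differentiable)
  have "\<bar>\<kappa> s * (c0 + c1 * s + c2 * s^2 + c3 * s^3 + c4 * s^4 + c5 * s^5)\<bar> \<le> C * f s y z"
    if "\<bar>s - x\<bar> < x" for s using dom[of s] that by linarith
  note * = weighted_quintic_dominated_at_zero[OF assms(1) this _ * assms(4,5), simplified assms(2), simplified]
  show "c0 + c1 * x + c2 * x^2 + c3 * x^3 + c4 * x^4 + c5 * x^5 = 0"
    and "c1 + 2 * c2 * x + 3 * c3 * x^2 + 4 * c4 * x^3 + 5 * c5 * x^4 = 0"
    using * by blast+
qed

section \<open>Dominated forms forced to vanish by the zeros of the family B form\<close>

lemma antisymmetric_quintic_zero:
  fixes x1 x2 x3 x4 x5 x6 x7 x8 x9 :: real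
  defines "\<phi> \<equiv> \<lambda>a b c. x1 * (b^5 - c^5) + x2 * a * (b^4 - c^4) + x3 * a^2 * (b^3 - c^3)
    + x4 * a^3 * (b^2 - c^2) + x5 * a^4 * (b - c) + x6 * b * c * (b^3 - c^3)
    + x7 * a * b * c * (b^2 - c^2) + x8 * a^2 * b * c * (b - c) + x9 * b^2 * c^2 * (b - c)"
  assumes dom: "\<And>a b c. 0 \<le> a \<Longrightarrow> 0 \<le> b \<Longrightarrow> 0 \<le> c \<Longrightarrow> \<bar>\<phi> a b c\<bar> \<le> C * f a b c"
  shows "\<phi> a b c = 0"
proof -
  have t0: "0 < t" using t_ge by simp
  \<comment> \<open>\<open>\<phi>\<close> is the general quintic antisymmetric in \<open>b\<close>,
    \<open>c\<close>. The edges \<open>c = 0\<close> and \<open>a = 0\<close> express all its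
    coefficients through \<open>x1\<close> except \<open>x7\<close> and \<open>x8\<close>.\<close>
  have ab: "\<bar>1 * (x1 + x2 * s + x3 * s^2 + x4 * s^3 + x5 * s^4 + 0 * s^5)\<bar> \<le> C * f s 1 0"
    if "0 \<le> s" for s
    using dom[of s 1 0] that by (simp add: \<phi>_def algebra_simps)
  note q = quintic_double_roots[OF uv v_neq
      dominated_on_line[OF u_pos f_u10 ab] dominated_on_line[OF v_pos f_v10 ab], unfolded u_plus_v]
  have sides1: "x2 = - (2 * (w + 2) * x1)" "x3 = ((w + 2)^2 + 2) * x1"
    "x4 = - (2 * (w + 2) * x1)" "x5 = x1"
    using q by simp_all
  have bc: "\<bar>1 * (- x1 + (- x6) * s + (- x9) * s^2 + x9 * s^3 + x6 * s^4 + x1 * s^5)\<bar> \<le> C * f s 1 0"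
    if "0 \<le> s" for s
  proof -
    have "\<phi> 0 s 1 = 1 * (- x1 + (- x6) * s + (- x9) * s^2 + x9 * s^3 + x6 * s^4 + x1 * s^5)"
      unfolding \<phi>_def power_one power_zero_numeral by algebra
    moreover have "f 0 s 1 = f s 1 0" by (metis f_sym)
    ultimately show ?thesis using dom[of 0 s 1] that by simp
  qed
  note q' = quintic_double_roots[OF uv v_neq
      dominated_on_line[OF u_pos f_u10 bc] dominated_on_line[OF v_pos f_v10 bc], unfolded u_plus_v]
  have sides2: "x6 = - x1 - 2 * (w + 2) * x1" "x9 = ((w + 2)^2 + 2) * x1 + 2 * (w + 2) * x1"
    using q' by simp_all
  \<comment> \<open>The lines through \<open>(1, t, 1)\<close> in the first and second directions
    supply the three remaining equations: the value and two partial derivatives.\<close>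
  have 1: "\<bar>1 * ((x1 * (t^5 - 1) + x6 * t * (t^3 - 1) + x9 * t^2 * (t - 1))
      + (x2 * (t^4 - 1) + x7 * t * (t^2 - 1)) * s + (x3 * (t^3 - 1) + x8 * t * (t - 1)) * s^2
      + x4 * (t^2 - 1) * s^3 + x5 * (t - 1) * s^4 + 0 * s^5)\<bar> \<le> C * f s t 1"
    if "0 \<le> s" for s
    using dom[of s t 1] that t0 by (simp add: \<phi>_def algebra_simps)
  have z1: "f 1 t 1 = 0" using f_t11 by (metis f_sym)
  note e1 = dominated_on_line[OF zero_less_one z1 1, simplified]
  have 2: "\<bar>1 * ((- x1 - x2 - x3 - x4 - x5) + (x5 - x6 - x7 - x8) * s + (x4 + x8 - x9) * s^2
      + (x3 + x7 + x9) * s^3 + (x2 + x6) * s^4 + x1 * s^5)\<bar> \<le> C * f s 1 1"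
    if "0 \<le> s" for s
  proof -
    have "\<phi> 1 s 1 = 1 * ((- x1 - x2 - x3 - x4 - x5) + (x5 - x6 - x7 - x8) * s + (x4 + x8 - x9) * s^2
      + (x3 + x7 + x9) * s^3 + (x2 + x6) * s^4 + x1 * s^5)"
      unfolding \<phi>_def power_one power_zero_numeral by algebra
    moreover have "f 1 s 1 = f s 1 1" by (metis f_sym)
    ultimately show ?thesis using dom[of 1 s 1] that by simp
  qed
  have E0: "(- x1 - x2 - x3 - x4 - x5) + (x5 - x6 - x7 - x8) * t + (x4 + x8 - x9) * t^2
      + (x3 + x7 + x9) * t^3 + (x2 + x6) * t^4 + x1 * t^5 = 0"
    by (rule dominated_on_line(1)[OF t0 f_t11 2]) simp_all
  have E1: "x2 * (t^4 - 1) + x7 * t * (t^2 - 1) + 2 * (x3 * (t^3 - 1) + x8 * t * (t - 1))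
      + 3 * (x4 * (t^2 - 1)) + 4 * (x5 * (t - 1)) = 0" 
    using e1(2) by (simp add: algebra_simps)
  have E2: "(x5 - x6 - x7 - x8) + 2 * (x4 + x8 - x9) * t + 3 * (x3 + x7 + x9) * t^2
     + 4 * (x2 + x6) * t^3 + 5 * x1 * t^4 = 0"
    by (rule dominated_on_line(2)[OF t0 f_t11 2]) simp_all
  note E = E0[unfolded sides1 sides2] E1[unfolded sides1 sides2] E2[unfolded sides1 sides2]
  \<comment> \<open>Eliminating \<open>x7\<close> and \<open>x8\<close> leaves a multiple of
    \<open>x1\<close>; here the assumption on \<open>bB1\<close> enters.\<close>
  have "(t - 1)^3 * bB1 t w * (t^2 + 4 * t - w) * x1 = 0"
    using E unfolding bB1_def by algebra
  moreover have "t^2 + 4 * t - w > 0"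
    using w_less t_ge zero_le_power2[of t] by linarith
  ultimately have x1: "x1 = 0" using b1 t_ge by auto
  have "t * (t - 1) * x8 = 0" using E(1,2) unfolding x1 by algebra
  then have x8: "x8 = 0" using t_ge by simp
  have "t * ((t - 1) * ((t + 1) * x7)) = 0" using E(1) unfolding x1 x8 by algebra
  then have x7: "x7 = 0" using t_ge by simp
  show ?thesis unfolding \<phi>_def sides1 sides2 x1 x7 x8 by simp
qed

text \<open>At an edge zero \<open>f\<close> is of order \<open>a\<close>, while the weight is of
  order \<open>sqrt a\<close>, so the quartic itself must vanish there. Substituting
  \<open>a = s^2\<close> makes both sides differentiable at 0.\<close>

lemma weighted_dominated_on_edge:
  assumes "0 < y" "f y 1 0 = 0"
    and dom: "\<And>a. 0 \<le> a \<Longrightarrow>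
      \<bar>sqrt (a * y) * (c0 + c1 * a + c2 * a^2 + c3 * a^3 + c4 * a^4)\<bar> \<le> C * f a y 1"
  shows "c0 = 0"
proof -
  let ?P = "\<lambda>s. sqrt y * s * (c0 + c1 * s^2 + c2 * s^4 + c3 * s^6 + c4 * s^8)"
  have "\<bar>?P s\<bar> \<le> C * f (s^2) y 1" for s
    using dom[of "s^2"] by (simp add: real_sqrt_mult abs_mult ac_simps flip: power_mult)
  moreover have "C * f (0^2) y 1 = 0" using assms(2) by (metis f_sym mult_zero_right zero_power2)
  moreover have "(\<lambda>s. C * f (s^2) y 1) differentiable (at 0)"
    unfolding eB_eq s0_def s1_def s2_def s3_def s4_def TT_def S1_def SS_def UU_def
    by (intro derivative_intros)
  moreover have "(?P has_real_derivative sqrt y * c0) (at 0)"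
    by (auto intro!: derivative_eq_intros)
  ultimately have "sqrt y * c0 = 0"
    using dominated_at_zero(2)[of 1 0 ?P "\<lambda>s. C * f (s^2) y 1" "sqrt y * c0"] by simp
  then show ?thesis using assms(1) by simp
qed

text \<open>\<open>K\<close> is the general quartic antisymmetric in \<open>a\<close>,
  \<open>b\<close>. The edge \<open>c = 0\<close> kills \<open>h0\<close> and \<open>h1\<close>, the
  edge \<open>a = 0\<close> leaves \<open>h2\<close> and \<open>h3\<close>, and the zero
  \<open>(t, 1, 1)\<close> gives two independent equations for these.\<close>

lemma antisymmetric_quartic_zero:
  fixes h0 h1 h2 h3 h4 h5 :: real
  defines "K \<equiv> \<lambda>a b c. h0 * (a^4 - b^4) + h1 * (a^3 * b - a * b^3)
    + c * (h2 * (a^3 - b^3) + h3 * (a * b) * (a - b)) + c^2 * h4 * (a^2 - b^2) + c^3 * h5 * (a - b)"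
  assumes dom: "\<And>a b c. 0 \<le> a \<Longrightarrow> 0 \<le> b \<Longrightarrow> 0 \<le> c \<Longrightarrow> \<bar>sqrt (a * b) * K a b c\<bar> \<le> C * f a b c"
  shows "K a b c = 0"
proof -
  have t0: "0 < t" using t_ge by simp
  have ab: "\<bar>sqrt (s * 1) * (- h0 + (- h1) * s + 0 * s^2 + h1 * s^3 + h0 * s^4 + 0 * s^5)\<bar> \<le> C * f s 1 0"
    if "0 \<le> s" for s
    using dom[of s 1 0] that by (simp add: K_def algebra_simps)
  note q = quintic_double_roots[OF uv v_neq
      dominated_on_line[OF u_pos f_u10 ab sqrt_mult_differentiable[OF u_pos]]
      dominated_on_line[OF v_pos f_v10 ab sqrt_mult_differentiable[OF v_pos]], unfolded u_plus_v]
  have h0: "h0 = 0" using q(4) u_pos by simp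
  have h1: "h1 = 0" using q(1) u_pos h0 by simp
  have edge: "h2 * x^2 + h4 * x + h5 = 0" if "0 < x" "f x 1 0 = 0" for x
  proof -
    have "\<bar>sqrt (s * x) * (- (h2 * x^3 + h4 * x^2 + h5 * x) + (h5 - h3 * x^2) * s
        + (h3 * x + h4) * s^2 + h2 * s^3 + 0 * s^4)\<bar> \<le> C * f s x 1" if "0 \<le> s" for s
    proof -
      have "K s x 1 = - (h2 * x^3 + h4 * x^2 + h5 * x) + (h5 - h3 * x^2) * s
        + (h3 * x + h4) * s^2 + h2 * s^3 + 0 * s^4" unfolding K_def h0 h1 power_one by algebra
      then show ?thesis using dom[of s x 1] that \<open>0 < x\<close> by simp
    qed
    from weighted_dominated_on_edge[OF that this] have "x * (h2 * x^2 + h4 * x + h5) = 0"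
      by (simp add: algebra_simps power2_eq_square power3_eq_cube)
    then show ?thesis using that by simp
  qed
  have "(u - v) * (h4 + (u + v) * h2) = 0"
    using edge[OF u_pos f_u10] edge[OF v_pos f_v10] by algebra
  then have h4: "h4 = - ((w + 2) * h2)" using v_neq unfolding u_plus_v by simp
  have h5: "h5 = h2" using edge[OF u_pos f_u10] uv u_plus_v unfolding h4 by algebra
  have 1: "\<bar>sqrt (s * 1) * ((- h2 - h4 - h5) + (h5 - h3) * s + (h3 + h4) * s^2 + h2 * s^3
      + 0 * s^4 + 0 * s^5)\<bar> \<le> C * f s 1 1" if "0 \<le> s" for s
  proof -
    have "K s 1 1 = (- h2 - h4 - h5) + (h5 - h3) * s + (h3 + h4) * s^2 + h2 * s^3
      + 0 * s^4 + 0 * s^5" unfolding K_def h0 h1 power_one by algebra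
    then show ?thesis using dom[of s 1 1] that by simp
  qed
  note e = dominated_on_line[OF t0 f_t11 1 sqrt_mult_differentiable]
  \<comment> \<open>The factor \<open>t - 1\<close> appears because \<open>K s 1 1\<close> vanishes
    at \<open>s = 1\<close> by antisymmetry.\<close>
  have "(t - 1) * ((t^2 + t + 2 - (w + 2) * (t + 1)) * h2 + t * h3) = 0"
    using e(1) t0 unfolding h4 h5 by (simp, algebra)
  then have E1: "(t^2 + t + 2 - (w + 2) * (t + 1)) * h2 + t * h3 = 0" using t_ge by simp
  have E2: "(3 * t^2 - 2 * (w + 2) * t + 1) * h2 + (2 * t - 1) * h3 = 0"
    using e(2) t0 unfolding h4 h5 by (simp, algebra)
  have "(t - 1) * (t^2 + w) * h2 = 0" using E1 E2 by algebra
  moreover have "t^2 + w > 0" using w_pos by (simp add: add_nonneg_pos)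
  ultimately have h2: "h2 = 0" using t_ge by simp
  have "h3 = 0" using E1 t_ge unfolding h2 by simp
  then show ?thesis unfolding K_def h0 h1 h4 h5 h2 by simp
qed

text \<open>\<open>K\<close> is the general quartic symmetric in \<open>a\<close>, \<open>b\<close>.
  The edges leave the unknowns \<open>k0\<close>, \<open>m\<close>, \<open>k8\<close>,
  \<open>k4\<close>, \<open>k6\<close>; they are matched by value and \<open>c\<close>-derivative at
  \<open>(1, 1, t)\<close> and by value, \<open>a\<close>- and \<open>b\<close>-derivative at
  \<open>(t, 1, 1)\<close>.\<close>

lemma symmetric_quartic_zero:
  fixes k0 k1 k2 k3 k4 k5 k6 k7 k8 :: real
  defines "K \<equiv> \<lambda>a b c. k0 * (a^4 + b^4) + k1 * (a^3 * b + a * b^3) + k2 * (a * b)^2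
    + c * (k3 * (a^3 + b^3) + k4 * (a * b) * (a + b)) + c^2 * (k5 * (a^2 + b^2) + k6 * (a * b))
    + c^3 * k7 * (a + b) + c^4 * k8"
  assumes dom: "\<And>a b c. 0 \<le> a \<Longrightarrow> 0 \<le> b \<Longrightarrow> 0 \<le> c \<Longrightarrow> \<bar>sqrt (a * b) * K a b c\<bar> \<le> C * f a b c"
  shows "K a b c = 0"
proof -
  have t0: "0 < t" using t_ge by simp
  have ab: "\<bar>sqrt (s * 1) * (k0 + k1 * s + k2 * s^2 + k1 * s^3 + k0 * s^4 + 0 * s^5)\<bar> \<le> C * f s 1 0"
    if "0 \<le> s" for s
    using dom[of s 1 0] that by (simp add: K_def algebra_simps)
  note q = quintic_double_roots[OF uv v_neq
      dominated_on_line[OF u_pos f_u10 ab sqrt_mult_differentiable[OF u_pos]]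
      dominated_on_line[OF v_pos f_v10 ab sqrt_mult_differentiable[OF v_pos]], unfolded u_plus_v]
  have k1: "k1 = - (2 * (w + 2) * k0)" and k2: "k2 = ((w + 2)^2 + 2) * k0"
    using q(1,2) u_pos by simp_all
  have edge: "k0 * x^4 + k3 * x^3 + k5 * x^2 + k7 * x + k8 = 0" if "0 < x" "f x 1 0 = 0" for x
  proof -
    have "\<bar>sqrt (s * x) * ((k0 * x^4 + k3 * x^3 + k5 * x^2 + k7 * x + k8)
        + (k1 * x^3 + k4 * x^2 + k6 * x + k7) * s
        + (k2 * x^2 + k4 * x + k5) * s^2 + (k1 * x + k3) * s^3 + k0 * s^4)\<bar> \<le> C * f s x 1" if "0 \<le> s" for s
    proof -
      have "K s x 1 = (k0 * x^4 + k3 * x^3 + k5 * x^2 + k7 * x + k8)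
        + (k1 * x^3 + k4 * x^2 + k6 * x + k7) * s
        + (k2 * x^2 + k4 * x + k5) * s^2 + (k1 * x + k3) * s^3 + k0 * s^4" unfolding K_def power_one by algebra
      then show ?thesis using dom[of s x 1] that \<open>0 < x\<close> by simp
    qed
    from weighted_dominated_on_edge[OF that this] show ?thesis .
  qed
  \<comment> \<open>\<open>K 0 x 1\<close> is \<open>x\<^sup>2 - (w + 2) x + 1\<close> times \<open>k0 x\<^sup>2 + m x + k8\<close>\<close>
  define m where "m = k3 + (w + 2) * k0"
  have k3: "k3 = m - (w + 2) * k0" by (simp add: m_def)
  have k57: "k5 = k8 - (w + 2) * m + k0" "k7 = m - (w + 2) * k8"
  proof -
    have "k5 = k8 - (x + y) * m' + k0 \<and> k7 = m' - (x + y) * k8"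
      if "x * y = 1" "x \<noteq> y" "k3 = m' - (x + y) * k0"
        "k0 * x^4 + k3 * x^3 + k5 * x^2 + k7 * x + k8 = 0"
        "k0 * y^4 + k3 * y^3 + k5 * y^2 + k7 * y + k8 = 0" for x y m'
    proof -
      have "(x - y) * (k7 - (m' - (x + y) * k8) + (x + y) * (k5 - (k8 - (x + y) * m' + k0))) = 0"
        using that(1,4,5) unfolding that(3) by algebra
      then have l: "k7 - (m' - (x + y) * k8) + (x + y) * (k5 - (k8 - (x + y) * m' + k0)) = 0"
        using that(2) by simp
      have "k5 - (k8 - (x + y) * m' + k0) = 0" using that(1,4) l unfolding that(3) by algebra
      then show ?thesis using l by simp
    qed
    from this[OF uv v_neq _ edge[OF u_pos f_u10] edge[OF v_pos f_v10], unfolded u_plus_v, OF k3]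
    show "k5 = k8 - (w + 2) * m + k0" "k7 = m - (w + 2) * k8" by simp_all
  qed
  note ks = k1 k2 k3 k57
  have 1: "\<bar>1 * ((2 * k0 + 2 * k1 + k2) + (2 * k3 + 2 * k4) * s + (2 * k5 + k6) * s^2 + 2 * k7 * s^3
      + k8 * s^4 + 0 * s^5)\<bar> \<le> C * f s 1 1" if "0 \<le> s" for s
  proof -
    have "K 1 1 s = (2 * k0 + 2 * k1 + k2) + (2 * k3 + 2 * k4) * s + (2 * k5 + k6) * s^2 + 2 * k7 * s^3
      + k8 * s^4 + 0 * s^5" by (simp add: K_def algebra_simps)
    moreover have "f 1 1 s = f s 1 1" by (metis f_sym)
    ultimately show ?thesis using dom[of 1 1 s] that by simp
  qed
  have 2: "\<bar>sqrt (s * 1) * ((k0 + k3 + k5 + k7 + k8) + (k1 + k4 + k6 + k7) * s + (k2 + k4 + k5) * s^2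
      + (k1 + k3) * s^3 + k0 * s^4 + 0 * s^5)\<bar> \<le> C * f s 1 1" if "0 \<le> s" for s
  proof -
    have "K s 1 1 = (k0 + k3 + k5 + k7 + k8) + (k1 + k4 + k6 + k7) * s + (k2 + k4 + k5) * s^2
      + (k1 + k3) * s^3 + k0 * s^4 + 0 * s^5" unfolding K_def power_one by algebra
    then show ?thesis using dom[of s 1 1] that by simp
  qed
  note e2 = dominated_on_line[OF t0 f_t11 2 sqrt_mult_differentiable]
  have 3: "\<bar>sqrt (s * t) * ((k0 * t^4 + k3 * t^3 + k5 * t^2 + k7 * t + k8)
      + (k1 * t^3 + k4 * t^2 + k6 * t + k7) * s + (k2 * t^2 + k4 * t + k5) * s^2
      + (k1 * t + k3) * s^3 + k0 * s^4 + 0 * s^5)\<bar> \<le> C * f s t 1" if "0 \<le> s" for s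
  proof -
    have "K t s 1 = (k0 * t^4 + k3 * t^3 + k5 * t^2 + k7 * t + k8)
      + (k1 * t^3 + k4 * t^2 + k6 * t + k7) * s + (k2 * t^2 + k4 * t + k5) * s^2
      + (k1 * t + k3) * s^3 + k0 * s^4 + 0 * s^5" unfolding K_def power_one by algebra
    moreover have "f t s 1 = f s t 1" by (rule f_sym)
    ultimately show ?thesis using dom[of t s 1] that t0 by (simp add: mult.commute)
  qed
  have z: "f 1 t 1 = 0" using f_t11 by (metis f_sym)
  note e3 = dominated_on_line[OF zero_less_one z 3 sqrt_mult_differentiable]
  have V1: "(2 * k0 + 2 * k1 + k2) + (2 * k3 + 2 * k4) * t + (2 * k5 + k6) * t^2 + 2 * k7 * t^3
      + k8 * t^4 = 0" and Dc: "(2 * k3 + 2 * k4) + 2 * (2 * k5 + k6) * t + 6 * k7 * t^2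
      + 4 * k8 * t^3 = 0" 
    using dominated_on_line[OF t0 f_t11 1] by simp_all
  have V2: "(k0 + k3 + k5 + k7 + k8) + (k1 + k4 + k6 + k7) * t + (k2 + k4 + k5) * t^2
      + (k1 + k3) * t^3 + k0 * t^4 = 0" and Da: "(k1 + k4 + k6 + k7) + 2 * (k2 + k4 + k5) * t
      + 3 * (k1 + k3) * t^2 + 4 * k0 * t^3 = 0"
    using e2 t0 by simp_all
  have Db: "(k1 * t^3 + k4 * t^2 + k6 * t + k7) + 2 * (k2 * t^2 + k4 * t + k5)
      + 3 * (k1 * t + k3) + 4 * k0 = 0"
    using e3(2) t0 by simp
  note E = V1[unfolded ks] Dc[unfolded ks] V2[unfolded ks] Da[unfolded ks] Db[unfolded ks]
  \<comment> \<open>\<open>A\<close> and \<open>C\<close> solve for \<open>k4\<close> and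
    \<open>k6\<close>. Substituting them and cancelling \<open>t - 1\<close> leaves the system
    \<open>R1\<close>, \<open>R2\<close>, \<open>R3\<close> in \<open>k0\<close>, \<open>m\<close>,
    \<open>k8\<close>.\<close>
  have A: "(t^4 - t^3 * w - 2 * t^3 - t^2 * w^2 - 4 * t^2 * w - 5 * t^2 + 4 * t * w + 8 * t + 2 * w) * k0
      + (t^3 - t^2 * w - 2 * t^2 + t + w) * m + (t^2 - t * w - 2 * t) * k8 - t * k4 = 0"
    using E(3,5) by algebra
  have C: "(2*t^5 - 2*t^4*w + t^4 - 2*t^3*w^2 - 18*t^3*w - 30*t^3 + t^2*w^2 + 12*t^2*w + 25*t^2 + 6*t*w + 4*t + 2*w) * k0
      + (2*t^4 - 2*t^3*w - 3*t^2*w - 4*t^2 + 2*t*w + 2*t + w) * m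
      + (2*t^3 - 2*t^2*w - t^2 - 2*t*w - 4*t) * k8 + t * k6 = 0"
    using E(4) A by algebra
  have "(t - 1) * ((t^4 - t^3*w + 2*t^3 - t^2*w^2 - 11*t^2*w - 15*t^2 - 3*t*w - w) * k0
      + (t + 1) * (t^2 - t * w - w) * m + (t^2 - t * w - w) * k8) = 0"
    using E(3,4) A by algebra
  then have R1: "(t^4 - t^3*w + 2*t^3 - t^2*w^2 - 11*t^2*w - 15*t^2 - 3*t*w - w) * k0
      + (t + 1) * (t^2 - t * w - w) * m + (t^2 - t * w - w) * k8 = 0" using t_ge by simp
  have "(t - 1) * ((-2*t^5 + 2*t^4*w - 3*t^4 + 2*t^3*w^2 + 20*t^3*w + 29*t^3 + t^2*w^2 + 6*t^2*w - t*w^2 - 8*t*w - 12*t - w^2 - 4*w) * k0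
      + (-2*t^4 + 2*t^3*w - 2*t^3 + 5*t^2*w + 6*t^2 - t*w - 4*t - 2*w) * m
      + t * (2*w + 4 - t^2 - 4*t) * k8) = 0"
    using E(1) A C by algebra
  then have R2: "(-2*t^5 + 2*t^4*w - 3*t^4 + 2*t^3*w^2 + 20*t^3*w + 29*t^3 + t^2*w^2 + 6*t^2*w - t*w^2 - 8*t*w - 12*t - w^2 - 4*w) * k0
      + (-2*t^4 + 2*t^3*w - 2*t^3 + 5*t^2*w + 6*t^2 - t*w - 4*t - 2*w) * m
      + t * (2*w + 4 - t^2 - 4*t) * k8 = 0" using t_ge by simp
  have "(t - 1) * ((t^2*w + t^2 + t*w^2 + 5*t*w + 6*t + w^2 + 2*w - t^3) * k0
      + (t*w + 2*t + w) * m + t * (t + 1) * (t - w - 2) * k8) = 0"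
    using E(1,2) A C by algebra
  then have R3: "(t^2*w + t^2 + t*w^2 + 5*t*w + 6*t + w^2 + 2*w - t^3) * k0
      + (t*w + 2*t + w) * m + t * (t + 1) * (t - w - 2) * k8 = 0" using t_ge by simp
  \<comment> \<open>The cofactor of \<open>bB1\<close> squared in the determinant of that system. It
    is positive once regrouped by \<open>t - 2 * w\<close> and \<open>t^2 - 2 * t\<close>.\<close>
  define R where "R = t^4 - t^3*w + 4*t^3 - 6*t^2*w + t*w^2 - 4*t*w + w^2"
  have "0 < R"
  proof -
    have "0 < t^3 * (t - 2 * w) + t^3 * w + 3 * t^2 * (t - 2 * w) + t * w^2 + (t * (t^2 - 2 * t) + 2 * t * (t - 2 * w) + w^2)"
      using t_ge w_less w_pos
      by (intro add_pos_nonneg add_nonneg_nonneg mult_pos_pos mult_nonneg_nonneg) (simp_all add: power2_eq_square)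
    also have "\<dots> = R" unfolding R_def by algebra
    finally show ?thesis .
  qed
  then have nz: "- ((t - 1)^2 * (bB1 t w)^2 * R) \<noteq> 0" using t_ge b1 by simp
  have det: "(t^4 - t^3*w + 2*t^3 - t^2*w^2 - 11*t^2*w - 15*t^2 - 3*t*w - w) * ((-2*t^4 + 2*t^3*w - 2*t^3 + 5*t^2*w + 6*t^2 - t*w - 4*t - 2*w) * (t * (t + 1) * (t - w - 2)) - (t*w + 2*t + w) * (t * (2*w + 4 - t^2 - 4*t)))
      - ((t + 1) * (t^2 - t * w - w)) * ((-2*t^5 + 2*t^4*w - 3*t^4 + 2*t^3*w^2 + 20*t^3*w + 29*t^3 + t^2*w^2 + 6*t^2*w - t*w^2 - 8*t*w - 12*t - w^2 - 4*w) * (t * (t + 1) * (t - w - 2)) - (t^2*w + t^2 + t*w^2 + 5*t*w + 6*t + w^2 + 2*w - t^3) * (t * (2*w + 4 - t^2 - 4*t)))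
      + (t^2 - t * w - w) * ((-2*t^5 + 2*t^4*w - 3*t^4 + 2*t^3*w^2 + 20*t^3*w + 29*t^3 + t^2*w^2 + 6*t^2*w - t*w^2 - 8*t*w - 12*t - w^2 - 4*w) * (t*w + 2*t + w) - (t^2*w + t^2 + t*w^2 + 5*t*w + 6*t + w^2 + 2*w - t^3) * (-2*t^4 + 2*t^3*w - 2*t^3 + 5*t^2*w + 6*t^2 - t*w - 4*t - 2*w))
      = - ((t - 1)^2 * (bB1 t w)^2 * R)"
    unfolding R_def bB1_def by algebra
  have k0: "k0 = 0" and m: "m = 0" and k8: "k8 = 0"
    by (rule cramer3[OF R1 R2 R3], unfold det, rule nz)+
  have k4: "k4 = 0" using A t_ge unfolding k0 m k8 by simp
  have k6: "k6 = 0" using C t_ge unfolding k0 m k8 by simp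
  show ?thesis unfolding K_def ks k0 m k8 k4 k6 by simp
qed

text \<open>There is no \<open>s0\<close> term because a multiple of \<open>f\<close>, whose
  \<open>s0\<close> coefficient is 1, gets subtracted beforehand. The edge kills \<open>z1\<close>
  and \<open>z2\<close>, the zero \<open>(t, 1, 1)\<close> the other two.\<close>

lemma symmetric_quintic_zero:
  fixes z1 z2 z3 z4 :: real
  defines "\<psi> \<equiv> \<lambda>a b c. z1 * s1 a b c + z2 * s2 a b c + z3 * s3 a b c + z4 * s4 a b c"
  assumes dom: "\<And>a b c. 0 \<le> a \<Longrightarrow> 0 \<le> b \<Longrightarrow> 0 \<le> c \<Longrightarrow> \<bar>\<psi> a b c\<bar> \<le> C * f a b c"
  shows "\<psi> a b c = 0"
proof -
  note defs = s1_def s2_def s3_def s4_def TT_def S1_def SS_def UU_def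
  have t0: "0 < t" using t_ge by simp
  have ab: "\<bar>1 * (0 + z1 * s + z2 * s^2 + z2 * s^3 + z1 * s^4 + 0 * s^5)\<bar> \<le> C * f s 1 0"
    if "0 \<le> s" for s
    using dom[of s 1 0] that by (simp add: \<psi>_def defs algebra_simps)
  note q = quintic_double_roots[OF uv v_neq
      dominated_on_line[OF u_pos f_u10 ab] dominated_on_line[OF v_pos f_v10 ab]]
  have z1: "z1 = 0" and z2: "z2 = 0" using q(1,2) by simp_all
  have d: "\<bar>1 * (0 + (z3 + z4) * s + (2 * z4 - 2 * z3) * s^2 + z3 * s^3 + 0 * s^4 + 0 * s^5)\<bar> \<le> C * f s 1 1"
    if "0 \<le> s" for s
  proof -
    have "\<psi> s 1 1 = 1 * (0 + (z3 + z4) * s + (2 * z4 - 2 * z3) * s^2 + z3 * s^3 + 0 * s^4 + 0 * s^5)"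
      by (simp add: \<psi>_def z1 z2 defs algebra_simps power2_eq_square power3_eq_cube)
    then show ?thesis using dom[of s 1 1] that by simp
  qed
  have "t * (z3 * (t - 1)^2 + z4 * (2 * t + 1)) = 0"
    using dominated_on_line(1)[OF t0 f_t11 d] by (simp, algebra)
  then have e1: "z3 * (t - 1)^2 + z4 * (2 * t + 1) = 0" using t0 by simp
  have e2: "z3 * (3 * t^2 - 4 * t + 1) + z4 * (4 * t + 1) = 0"
    using dominated_on_line(2)[OF t0 f_t11 d] by (simp, algebra)
  have "t * ((t - 1) * ((t + 2) * z3)) = 0" using e1 e2 by algebra
  then have z3: "z3 = 0" using t_ge by simp
  have z4: "z4 = 0" using e1 t_ge unfolding z3 by simp
  show ?thesis unfolding \<psi>_def z1 z2 z3 z4 by simp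
qed

section \<open>Decomposing dominated forms by symmetry and parity\<close>

lemma quintic_proportional:
  assumes form: "ternary_form 5 g"
    and dom: "\<And>a b c. 0 \<le> a \<Longrightarrow> 0 \<le> b \<Longrightarrow> 0 \<le> c \<Longrightarrow> 0 \<le> g a b c \<and> g a b c \<le> f a b c"
  shows "\<exists>l\<ge>0. g = (\<lambda>a b c. l * f a b c)"
proof -
  obtain C where C: "\<And>a b c. g a b c = (\<Sum>i\<le>5. \<Sum>j\<le>5 - i. C i j * a ^ i * b ^ j * c ^ (5 - i - j))"
    using form unfolding ternary_form_def by blast
  note expand = C sum_atMost_numeral
  have swap_bc: "g a c b = g a b c" for a b c
  proof -
    have eq: "g a b c - g a c b = (C 0 5 - C 0 0) * (b^5 - c^5) + (C 1 4 - C 1 0) * a * (b^4 - c^4)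
      + (C 2 3 - C 2 0) * a^2 * (b^3 - c^3) + (C 3 2 - C 3 0) * a^3 * (b^2 - c^2)
      + (C 4 1 - C 4 0) * a^4 * (b - c) + (C 0 4 - C 0 1) * b * c * (b^3 - c^3)
      + (C 1 3 - C 1 1) * a * b * c * (b^2 - c^2) + (C 2 2 - C 2 1) * a^2 * b * c * (b - c)
      + (C 0 3 - C 0 2) * b^2 * c^2 * (b - c)" for a b c
      by (simp add: expand) algebra
    \<comment> \<open>Two numbers in \<open>[0, f a b c]\<close> differ by at most
      \<open>f a b c\<close>.\<close>
    have "\<bar>g a b c - g a c b\<bar> \<le> 1 * f a b c" if "0 \<le> a" "0 \<le> b" "0 \<le> c" for a b c
      using dom[of a b c] dom[of a c b] that f_sym(2)[of a c b] by (simp add: abs_le_iff)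
    then have "g a b c - g a c b = 0"
      unfolding eq by (rule antisymmetric_quintic_zero)
    then show ?thesis by simp
  qed
  have swap_ab: "g b a c = g a b c" for a b c
  proof -
    have eq: "g a b c - g b a c = (C 5 0 - C 0 5) * (a^5 - b^5) + (C 4 0 - C 0 4) * c * (a^4 - b^4)
      + (C 3 0 - C 0 3) * c^2 * (a^3 - b^3) + (C 2 0 - C 0 2) * c^3 * (a^2 - b^2)
      + (C 1 0 - C 0 1) * c^4 * (a - b) + (C 4 1 - C 1 4) * a * b * (a^3 - b^3)
      + (C 3 1 - C 1 3) * c * a * b * (a^2 - b^2) + (C 2 1 - C 1 2) * c^2 * a * b * (a - b)
      + (C 3 2 - C 2 3) * a^2 * b^2 * (a - b)" for a b c
      by (simp add: expand) algebra
    have "\<bar>g a b c - g b a c\<bar> \<le> 1 * f c a b" if "0 \<le> c" "0 \<le> a" "0 \<le> b" for a b c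
      using dom[of a b c] dom[of b a c] that f_sym(1)[of a b c] f_sym(1)[of c a b] f_sym(2)[of a c b]
      by (simp add: abs_le_iff)
    then have "g a b c - g b a c = 0"
      unfolding eq by (rule antisymmetric_quintic_zero)
    then show ?thesis by simp
  qed
  \<comment> \<open>Averages of the coefficients over orbits of monomials. The sum multiplying
    \<open>s4\<close> below compensates for the terms subtracted in the definitions of
    \<open>s0\<close> to \<open>s3\<close>.\<close>
  define y0 y1 y2 y3 y4 where "y0 = (C 5 0 + C 0 5 + C 0 0) / 3"
    and "y1 = (C 4 1 + C 1 4 + C 4 0 + C 0 4 + C 1 0 + C 0 1) / 6"
    and "y2 = (C 3 2 + C 2 3 + C 3 0 + C 0 3 + C 2 0 + C 0 2) / 6"
    and "y3 = (C 3 1 + C 1 3 + C 1 1) / 3" and "y4 = (C 2 2 + C 2 1 + C 1 2) / 3"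
  have "g a b c = (g a b c + g b a c + g a c b + g c a b + g b c a + g c b a) / 6" for a b c
  proof -
    have "g b a c = g a b c" "g a c b = g a b c" "g c a b = g a b c" "g b c a = g a b c" "g c b a = g a b c"
      by (metis swap_ab swap_bc)+
    then show ?thesis by (simp only:) simp
  qed
  also have "(g a b c + g b a c + g a c b + g c a b + g b c a + g c b a) / 6
      = y0 * s0 a b c + y1 * s1 a b c + y2 * s2 a b c + y3 * s3 a b c
        + (y4 + y0 + 2 * y1 + 2 * y2 + y3) * s4 a b c" for a b c
    unfolding s0_def s1_def s2_def s3_def s4_def TT_def S1_def SS_def UU_def y0_def y1_def y2_def y3_def y4_def
    by (simp add: expand) algebra
  finally have g: "g a b c = y0 * s0 a b c + y1 * s1 a b c + y2 * s2 a b c + y3 * s3 a b c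
        + (y4 + y0 + 2 * y1 + 2 * y2 + y3) * s4 a b c" for a b c .
  have eq: "g a b c - y0 * f a b c = (y1 - y0 * pB1 t w) * s1 a b c + (y2 - y0 * pB2 t w) * s2 a b c
    + (y3 - y0 * pB3 t w) * s3 a b c + (y4 + y0 + 2 * y1 + 2 * y2 + y3 - y0 * pB4 t w) * s4 a b c" for a b c
    unfolding g eB_eq by algebra
  have "\<bar>g a b c - y0 * f a b c\<bar> \<le> (1 + \<bar>y0\<bar>) * f a b c" if "0 \<le> a" "0 \<le> b" "0 \<le> c" for a b c
  proof -
    have "\<bar>g a b c - y0 * f a b c\<bar> \<le> \<bar>g a b c\<bar> + \<bar>y0\<bar> * \<bar>f a b c\<bar>"
      by (metis abs_mult abs_triangle_ineq4)
    also have "\<dots> \<le> f a b c + \<bar>y0\<bar> * f a b c"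
      using dom[OF that] f_nonneg[OF that] by simp
    finally show ?thesis by (simp add: distrib_right)
  qed
  then have "g a b c - y0 * f a b c = 0" for a b c
    unfolding eq by (rule symmetric_quintic_zero)
  then have l: "g = (\<lambda>a b c. y0 * f a b c)" by (intro ext) simp
  have "f 1 0 0 = 1" by (simp add: f_edge)
  then have "0 \<le> y0" using dom[of 1 0 0] by (simp add: l)
  then show ?thesis using l by blast
qed

text \<open>The weight and \<open>f\<close> are symmetric in \<open>a\<close>, \<open>b\<close>, so
  the symmetric and antisymmetric parts of \<open>K\<close> are dominated by multiples of
  \<open>f\<close> and vanish separately.\<close>

lemma quartic_zero:
  fixes \<kappa> :: "nat \<Rightarrow> nat \<Rightarrow> real"
  defines "K \<equiv> \<lambda>a b c. \<Sum>i\<le>4. \<Sum>j\<le>4 - i. \<kappa> i j * a ^ i * b ^ j * c ^ (4 - i - j)"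
  assumes dom: "\<And>a b c. 0 \<le> a \<Longrightarrow> 0 \<le> b \<Longrightarrow> 0 \<le> c \<Longrightarrow> \<bar>sqrt (a * b) * K a b c\<bar> \<le> f a b c"
  shows "K a b c = 0"
proof -
  note expand = K_def sum_atMost_numeral
  have dom2: "\<bar>sqrt (a * b) * K b a c\<bar> \<le> f a b c" if "0 \<le> a" "0 \<le> b" "0 \<le> c" for a b c
    using dom[of b a c] that f_sym(1)[of a b c] by (simp add: mult.commute)
  have tri: "\<bar>x * (y + z)\<bar> \<le> 2 * e" "\<bar>x * (y - z)\<bar> \<le> 2 * e" if "\<bar>x * y\<bar> \<le> e" "\<bar>x * z\<bar> \<le> e" for x y z e :: real
    using that by (simp_all add: distrib_left right_diff_distrib abs_le_iff)
  have e1: "K a b c + K b a c = (\<kappa> 4 0 + \<kappa> 0 4) * (a^4 + b^4) + (\<kappa> 3 1 + \<kappa> 1 3) * (a^3 * b + a * b^3)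
      + 2 * \<kappa> 2 2 * (a * b)^2 + c * ((\<kappa> 3 0 + \<kappa> 0 3) * (a^3 + b^3) + (\<kappa> 2 1 + \<kappa> 1 2) * (a * b) * (a + b))
      + c^2 * ((\<kappa> 2 0 + \<kappa> 0 2) * (a^2 + b^2) + 2 * \<kappa> 1 1 * (a * b))
      + c^3 * (\<kappa> 1 0 + \<kappa> 0 1) * (a + b) + c^4 * (2 * \<kappa> 0 0)" for a b c
    by (simp add: expand) algebra
  have e2: "K a b c - K b a c = (\<kappa> 4 0 - \<kappa> 0 4) * (a^4 - b^4) + (\<kappa> 3 1 - \<kappa> 1 3) * (a^3 * b - a * b^3)
      + c * ((\<kappa> 3 0 - \<kappa> 0 3) * (a^3 - b^3) + (\<kappa> 2 1 - \<kappa> 1 2) * (a * b) * (a - b))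
      + c^2 * (\<kappa> 2 0 - \<kappa> 0 2) * (a^2 - b^2) + c^3 * (\<kappa> 1 0 - \<kappa> 0 1) * (a - b)" for a b c
    by (simp add: expand) algebra
  have "K a b c + K b a c = 0"
    unfolding e1 by (rule symmetric_quartic_zero, fold e1, rule tri(1)[OF dom dom2])
  moreover have "K a b c - K b a c = 0"
    unfolding e2 by (rule antisymmetric_quartic_zero, fold e2, rule tri(2)[OF dom dom2])
  ultimately show ?thesis by simp
qed

lemma f_form: "ternary_form 5 f"
proof -
  \<comment> \<open>The largest exponent determines the orbit of a monomial, except that 3 occurs in
    both (3,2,0) and (3,1,1).\<close>
  define C :: "nat \<Rightarrow> nat \<Rightarrow> real" where "C i j = (let k = 5 - i - j; m = max i (max j k) in
      if m = 5 then 1 else if m = 4 then pB1 t w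
      else if m = 3 then (if i * j * k = 0 then pB2 t w else pB3 t w)
      else pB4 t w - 1 - 2 * pB1 t w - 2 * pB2 t w - pB3 t w)" for i j
  have "f a b c = (\<Sum>i\<le>5. \<Sum>j\<le>5 - i. C i j * a ^ i * b ^ j * c ^ (5 - i - j))" for a b c
    unfolding eB_eq s0_def s1_def s2_def s3_def s4_def TT_def S1_def SS_def UU_def
    by (simp add: sum_atMost_numeral C_def) algebra
  then show ?thesis unfolding ternary_form_def by blast
qed


lemma decic_proportional:
  assumes form: "ternary_form 10 G"
    and dom: "\<And>a b c. 0 \<le> G a b c \<and> G a b c \<le> f (a^2) (b^2) (c^2)"
  shows "\<exists>l\<ge>0. G = (\<lambda>a b c. l * f (a^2) (b^2) (c^2))"
proof -
  obtain C where C: "\<And>a b c. G a b c = (\<Sum>i\<le>10. \<Sum>j\<le>10 - i. C i j * a ^ i * b ^ j * c ^ (10 - i - j))"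
    using form unfolding ternary_form_def by blast
  note expand = C sum_atMost_numeral
  \<comment> \<open>In even total degree the exponents are all even or exactly two are odd, which
    gives these four parity classes.\<close>
  define Kab Kac Kbc E where
    "Kab a b c = (\<Sum>i\<le>4. \<Sum>j\<le>4 - i. C (2 * i + 1) (2 * j + 1) * a ^ i * b ^ j * c ^ (4 - i - j))"
    and "Kac a c b = (\<Sum>i\<le>4. \<Sum>j\<le>4 - i. C (2 * i + 1) (2 * (4 - i - j)) * a ^ i * c ^ j * b ^ (4 - i - j))"
    and "Kbc b c a = (\<Sum>i\<le>4. \<Sum>j\<le>4 - i. C (2 * (4 - i - j)) (2 * i + 1) * b ^ i * c ^ j * a ^ (4 - i - j))"
    and "E a b c = (\<Sum>i\<le>5. \<Sum>j\<le>5 - i. C (2 * i) (2 * j) * a ^ i * b ^ j * c ^ (5 - i - j))"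
    for a b c :: real
  note parts = Kab_def Kac_def Kbc_def E_def
  have dec: "G a b c = E (a^2) (b^2) (c^2) + a * b * Kab (a^2) (b^2) (c^2)
      + a * c * Kac (a^2) (c^2) (b^2) + b * c * Kbc (b^2) (c^2) (a^2)" for a b c
    by (simp add: expand parts) algebra
  have Kab: "Kab a b c = 0" for a b c
    unfolding Kab_def
  proof (rule quartic_zero, fold Kab_def)
    fix a b c :: real assume *: "0 \<le> a" "0 \<le> b" "0 \<le> c"
    \<comment> \<open>Four times the \<open>Kab\<close> term is
      \<open>G x y z + G x y (-z) - G x (-y) z - G (-x) y z\<close>, and each value lies between 0
      and \<open>f (x^2) (y^2) (z^2)\<close>. The other two classes use other signs.\<close>
    have "\<bar>x * y * Kab (x^2) (y^2) (z^2)\<bar> \<le> f (x^2) (y^2) (z^2)" for x y z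
      using dec[of x y z] dec[of x y "-z"] dec[of x "-y" z] dec[of "-x" y z]
        dom[of x y z] dom[of x y "-z"] dom[of x "-y" z] dom[of "-x" y z]
      by (simp add: abs_le_iff)
    from this[of "sqrt a" "sqrt b" "sqrt c"] show "\<bar>sqrt (a * b) * Kab a b c\<bar> \<le> f a b c"
      using * by (simp add: real_sqrt_mult)
  qed
  have Kac: "Kac a b c = 0" for a b c
    unfolding Kac_def
  proof (rule quartic_zero, fold Kac_def)
    fix a b c :: real assume *: "0 \<le> a" "0 \<le> b" "0 \<le> c"
    have "\<bar>x * z * Kac (x^2) (z^2) (y^2)\<bar> \<le> f (x^2) (y^2) (z^2)" for x y z
      using dec[of x y z] dec[of x y "-z"] dec[of x "-y" z] dec[of "-x" y z]
        dom[of x y z] dom[of x y "-z"] dom[of x "-y" z] dom[of "-x" y z]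
      by (simp add: abs_le_iff)
    from this[of "sqrt a" "sqrt b" "sqrt c"] show "\<bar>sqrt (a * b) * Kac a b c\<bar> \<le> f a b c"
      using * f_sym(2)[of a b c] by (simp add: real_sqrt_mult)
  qed
  have Kbc: "Kbc a b c = 0" for a b c
    unfolding Kbc_def
  proof (rule quartic_zero, fold Kbc_def)
    fix a b c :: real assume *: "0 \<le> a" "0 \<le> b" "0 \<le> c"
    have "\<bar>y * z * Kbc (y^2) (z^2) (x^2)\<bar> \<le> f (x^2) (y^2) (z^2)" for x y z
      using dec[of x y z] dec[of x y "-z"] dec[of x "-y" z] dec[of "-x" y z]
        dom[of x y z] dom[of x y "-z"] dom[of x "-y" z] dom[of "-x" y z]
      by (simp add: abs_le_iff)
    from this[where y="sqrt a" and z="sqrt b" and x="sqrt c"] show "\<bar>sqrt (a * b) * Kbc a b c\<bar> \<le> f a b c"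
      using * f_sym(2)[of a c b] f_sym(1)[of a c b] by (simp add: real_sqrt_mult)
  qed
  have G: "G a b c = E (a^2) (b^2) (c^2)" for a b c unfolding dec Kab Kac Kbc by simp
  have "ternary_form 5 E" unfolding ternary_form_def E_def
    by (rule exI[of _ "\<lambda>i j. C (2 * i) (2 * j)"]) simp
  moreover have "0 \<le> E a b c \<and> E a b c \<le> f a b c" if "0 \<le> a" "0 \<le> b" "0 \<le> c" for a b c
    using dom[of "sqrt a" "sqrt b" "sqrt c"] that by (simp add: G)
  ultimately obtain l where "l \<ge> 0" "E = (\<lambda>a b c. l * f a b c)"
    using quintic_proportional by blast
  then have "G = (\<lambda>a b c. l * f (a^2) (b^2) (c^2))" by (intro ext) (simp add: G)
  then show ?thesis using \<open>l \<ge> 0\<close> by blast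
qed

section \<open>Extremality in both cones\<close>

lemma extremal_quintic: "extremal P_plus_3_5 f"
  unfolding extremal_def
proof (intro conjI allI impI)
  show "f \<in> P_plus_3_5" using f_form f_nonneg by (simp add: P_plus_3_5_def)
  have "f 1 0 0 = 1" by (simp add: f_edge)
  then show "f \<noteq> (\<lambda>a b c. 0)" by (metis zero_neq_one)
  fix g h assume g: "g \<in> P_plus_3_5" and h: "h \<in> P_plus_3_5" and eq: "f = (\<lambda>a b c. g a b c + h a b c)"
  have *: "f a b c = g a b c + h a b c" for a b c using eq by metis
  show "\<exists>l\<ge>0. g = (\<lambda>a b c. l * f a b c)" "\<exists>l\<ge>0. h = (\<lambda>a b c. l * f a b c)"
    by (rule quintic_proportional; use g h in \<open>simp add: P_plus_3_5_def *\<close>)+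
qed

lemma extremal_decic: "extremal P_3_10 (\<lambda>a b c. f (a^2) (b^2) (c^2))"
  unfolding extremal_def
proof (intro conjI allI impI)
  show "(\<lambda>a b c. f (a^2) (b^2) (c^2)) \<in> P_3_10"
    using ternary_form_squares[OF f_form] f_nonneg by (simp add: P_3_10_def)
  have "f (1^2) (0^2) (0^2) = 1" by (simp add: f_edge)
  then show "(\<lambda>a b c. f (a^2) (b^2) (c^2)) \<noteq> (\<lambda>a b c. 0)" by (metis zero_neq_one)
  fix g h assume g: "g \<in> P_3_10" and h: "h \<in> P_3_10"
    and eq: "(\<lambda>a b c. f (a^2) (b^2) (c^2)) = (\<lambda>a b c. g a b c + h a b c)"
  have *: "f (a^2) (b^2) (c^2) = g a b c + h a b c" for a b c using eq by metis
  show "\<exists>l\<ge>0. g = (\<lambda>a b c. l * f (a^2) (b^2) (c^2))" "\<exists>l\<ge>0. h = (\<lambda>a b c. l * f (a^2) (b^2) (c^2))"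
    by (rule decic_proportional; use g h in \<open>simp add: P_3_10_def *\<close>)+
qed

end

theorem theorem4p28:
  fixes t u :: real
  assumes "2 \<le> t" and "mu_B t \<le> u" and "u < 1"
    and "bB1 t (omega u) \<noteq> 0"
  shows "extremal P_plus_3_5 (eB t u)
       \<and> extremal P_3_10 (\<lambda>a b c. eB t u (a ^ 2) (b ^ 2) (c ^ 2))"
proof -
  interpret family_B t u using assms by unfold_locales
  show ?thesis using extremal_quintic extremal_decic by blast
qed

end
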